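(* Let $F$ be an arbitrary field and let $P$ be a three-dimensional Poisson algebra over $F$ such that $[P,P]=P$. Then the associated Lie algebra of $P$ is simple and $P^2=0$. Conversely, every three-dimensional simple Lie algebra over $F$, equipped with the zero associative multiplication, is a Poisson algebra.
   Context: A Poisson algebra over a field $F$ is an $F$-vector space $P$ with two $F$-bilinear operations: a commutative associative multiplication $(x,y)\mapsto xy$ (not assumed to have an identity) and a Lie multiplication $(x,y)\mapsto[x,y]$ (alternating, $[x,x]=0$ for all $x$, and satisfying the Jacobi identity), such that $[xy,z]=x[y,z]+y[x,z]$ for all $x,y,z\in P$. The associated Lie algebra is $P$ with only the Lie multiplication. $[P,P]$ is the $F$-span of all brackets $[x,y]$, and $P^2$ is the $F$-span of all associative products $xy$, $x,y\in P$. A Lie algebra is simple if it is non-abelian and has no non-zero proper ideals. *)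

theory Defs
  imports Complex_Main
begin

text \<open>
  The underlying vector space over a field is the whole type \<open>'a\<close>,
  with scalar multiplication \<open>scale\<close>.
\<close>

definition bilinear_op :: "('f::field \<Rightarrow> 'a::ab_group_add \<Rightarrow> 'a) \<Rightarrow> ('a \<Rightarrow> 'a \<Rightarrow> 'a) \<Rightarrow> bool" where
  "bilinear_op scale m \<longleftrightarrow>
     (\<forall>x. Vector_Spaces.linear scale scale (\<lambda>y. m x y)) \<and>
     (\<forall>y. Vector_Spaces.linear scale scale (\<lambda>x. m x y))"

locale lie_algebra = vector_space scale
  for scale :: "'f::field \<Rightarrow> 'a::ab_group_add \<Rightarrow> 'a" +
  fixes bracket :: "'a \<Rightarrow> 'a \<Rightarrow> 'a"
  assumes bracket_bilinear: "bilinear_op scale bracket"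
    and bracket_self: "bracket x x = 0"
    and jacobi: "bracket x (bracket y z) + bracket y (bracket z x) + bracket z (bracket x y) = 0"
begin

definition derived :: "'a set" where
  "derived = span {bracket x y | x y. True}"

text \<open>One-sided absorption suffices, because the bracket is antisymmetric.\<close>

definition lie_ideal :: "'a set \<Rightarrow> bool" where
  "lie_ideal I \<longleftrightarrow> subspace I \<and> (\<forall>x\<in>I. \<forall>y. bracket x y \<in> I)"

definition abelian :: bool where
  "abelian \<longleftrightarrow> (\<forall>x y. bracket x y = 0)"

definition simple :: bool where
  "simple \<longleftrightarrow> \<not> abelian \<and> (\<forall>I. lie_ideal I \<longrightarrow> I = {0} \<or> I = UNIV)"

end

locale poisson_algebra = lie_algebra scale bracket
  for scale :: "'f::field \<Rightarrow> 'a::ab_group_add \<Rightarrow> 'a"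
    and bracket :: "'a \<Rightarrow> 'a \<Rightarrow> 'a" +
  fixes mult :: "'a \<Rightarrow> 'a \<Rightarrow> 'a"
  assumes mult_bilinear: "bilinear_op scale mult"
    and mult_commute: "mult x y = mult y x"
    and mult_assoc: "mult (mult x y) z = mult x (mult y z)"
    and leibniz: "bracket (mult x y) z = mult x (bracket y z) + mult y (bracket x z)"
begin

definition square :: "'a set" where
  "square = span {mult x y | x y. True}"

end

end

theory Submission
  imports Defs
begin

text \<open>
  Simplicity is a matter of counting.  The bracket of a three-dimensional Lie algebra is determined
  by the three brackets of the members of a basis, so if the algebra is perfect, these three
  brackets form a basis again.  Hence an ideal containing \<open>a \<noteq> 0\<close> contains the two independent
  elements \<open>[a,b]\<close> and \<open>[a,c]\<close> for any basis \<open>a, b, c\<close> that extends \<open>a\<close>; and an ideal containing two members of a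
  basis contains all three of its brackets, so it is everything
  (lemma \<open>simple_if_perfect_dim_3\<close>).

  The product vanishes because \<open>P\<^sup>2\<close> is a Lie ideal, by the Leibniz rule.  If it were nonzero,
  simplicity would give \<open>P\<^sup>2 = P\<close>.  A finite-dimensional commutative algebra with this property has
  an identity \<open>e\<close> (lemma \<open>identity_if_square_UNIV\<close>, a form of Nakayama's lemma).  The identity is
  central for the bracket, since \<open>[e,z] = [ee,z] = 2e[e,z] = 2[e,z]\<close>, whereas the centre of a simple
  Lie algebra is zero.  No step divides by an integer, so the characteristic is irrelevant.
\<close>

section \<open>Commutative algebras that equal their square\<close>

locale commutative_algebra = vector_space scale
  for scale :: "'f::field \<Rightarrow> 'a::ab_group_add \<Rightarrow> 'a" +
  fixes mult :: "'a \<Rightarrow> 'a \<Rightarrow> 'a"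
  assumes bilinear: "bilinear_op scale mult"
    and commute: "mult x y = mult y x"
    and assoc: "mult (mult x y) z = mult x (mult y z)"
begin

lemma linear_right: "Vector_Spaces.linear scale scale (mult x)"
  using bilinear by (simp add: bilinear_op_def)

lemma mult_add_right: "mult x (y + z) = mult x y + mult x z"
  using linear_right[of x] by (simp add: Vector_Spaces.linear_iff)

lemma mult_scale_right: "mult x (scale r y) = scale r (mult x y)"
  using linear_right[of x] by (simp add: Vector_Spaces.linear_iff)

lemma mult_zero_right: "mult x 0 = 0"
  using mult_add_right[of x 0 0] by simp

lemma mult_zero_left: "mult 0 x = 0"
  by (metis commute mult_zero_right)

lemma mult_scale_left: "mult (scale r x) y = scale r (mult x y)"
  by (metis commute mult_scale_right)

lemma mult_add_left: "mult (x + y) z = mult x z + mult y z"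
  by (metis commute mult_add_right)

lemma mult_diff_right: "mult x (y - z) = mult x y - mult x z"
  by (metis add_diff_cancel diff_add_cancel mult_add_right)

lemma mult_diff_left: "mult (x - y) z = mult x z - mult y z"
  by (metis commute mult_diff_right)

lemma left_commute: "mult x (mult y z) = mult y (mult x z)"
  by (metis assoc commute)

definition products :: "'a set \<Rightarrow> 'a set" where
  "products S = span {mult p s | p s. s \<in> S}"

lemma products_memI: "s \<in> S \<Longrightarrow> mult p s \<in> products S"
  unfolding products_def by (rule span_base) blast

lemma products_absorb:
  assumes "x \<in> products S"
  shows "mult q x \<in> products S"
  using assms unfolding products_def
proof (induction rule: span_induct_alt)
  case base
  then show ?case by (simp add: mult_zero_right span_zero)
next
  case (step r m y)
  then obtain p s where "m = mult p s" "s \<in> S" by blast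
  then have "mult q m \<in> span {mult p s | p s. s \<in> S}"
    by (metis assoc products_def products_memI)
  with step show ?case
    by (simp add: mult_add_right mult_scale_right span_add span_scale)
qed

lemma products_span: "products (span S) = products S"
proof
  have "mult p x \<in> products S" if "x \<in> span S" for p x
    using that
  proof (induction rule: span_induct_alt)
    case base
    then show ?case by (simp add: mult_zero_right products_def span_zero)
  next
    case (step r s y)
    then show ?case
      using products_memI[of s S p]
      by (simp add: mult_add_right mult_scale_right products_def span_add span_scale)
  qed
  then show "products (span S) \<subseteq> products S"
    unfolding products_def[of "span S"] products_def[of S] by (intro span_minimal) auto
  show "products S \<subseteq> products (span S)"
    unfolding products_def by (intro span_mono) (auto intro: span_base)
qed

lemma products_insert:
  assumes "x \<in> products (insert s S)"
  shows "\<exists>p. x - mult p s \<in> products S"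
  using assms unfolding products_def[of "insert s S"]
proof (induction rule: span_induct_alt)
  case base
  then show ?case
    by (intro exI[of _ 0]) (simp add: mult_zero_left products_def span_zero)
next
  case (step r m y)
  then obtain q where q: "y - mult q s \<in> products S" by blast
  obtain p t where m: "m = mult p t" "t = s \<or> t \<in> S" using step by blast
  show ?case
  proof (cases "t = s")
    case True
    have "scale r m + y - mult (scale r p + q) s = y - mult q s"
      using True m by (simp add: mult_add_left mult_scale_left)
    with q show ?thesis by metis
  next
    case False
    then have "scale r m \<in> products S"
      using m products_memI[of t S p] by (simp add: products_def span_scale)
    with q have "scale r m + (y - mult q s) \<in> products S"
      unfolding products_def by (rule span_add[rotated])
    then show ?thesis by (metis add_diff_eq)
  qed
qed

text \<open>
  In the algebra with an identity adjoined, with \<open>PS\<close> the ideal \<open>products S\<close>, the hypothesis is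
  \<open>(1 - e)P \<subseteq> PS\<close>, and the generators in \<open>S\<close> are eliminated one at a time.
  Let \<open>S'\<close> be \<open>S\<close> without \<open>s\<close>.  Writing \<open>(1 - e)s\<close> as \<open>ps\<close> plus an element of the ideal
  \<open>PS'\<close> gives \<open>(1 - e - p)s \<in> PS'\<close>, so \<open>(1 - e - p)(1 - e)\<close> maps \<open>P\<close> into \<open>PS'\<close>.
  This product is \<open>1 - e'\<close> for an \<open>e'\<close> in \<open>P\<close>, so adjoining an identity is only a way of speaking.
\<close>

lemma eliminate_generators:
  assumes "finite S" and "\<forall>x. x - mult e x \<in> products S"
  shows "\<exists>e. \<forall>x. mult e x = x"
  using assms
proof (induction S arbitrary: e rule: finite_induct)
  case empty
  then show ?case by (auto simp: products_def intro: exI[of _ e])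
next
  case (insert s S)
  obtain p where p: "s - mult e s - mult p s \<in> products S"
    using insert.prems products_insert by blast
  define d where "d = e + p"
  have ds: "s - mult d s \<in> products S"
    using p by (simp add: d_def mult_add_left algebra_simps)
  have "x - mult (d + e - mult d e) x \<in> products S" for x
  proof -
    obtain q where q: "x - mult e x - mult q s \<in> products S" (is "?r \<in> _")
      using insert.prems products_insert by blast
    have "x - mult (d + e - mult d e) x = (?r - mult d ?r) + mult q (s - mult d s)"
      by (simp add: mult_add_left mult_add_right mult_diff_left mult_diff_right assoc left_commute[of q d]
          algebra_simps)
    then show ?thesis
      using q ds products_absorb unfolding products_def
      by (metis (no_types, lifting) span_add span_diff)
  qed
  then show ?case using insert.IH by blast
qed

lemma identity_if_square_UNIV:
  assumes "finite B" and "span B = UNIV" and "span {mult x y | x y. True} = UNIV"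
  shows "\<exists>e. \<forall>x. mult e x = x"
proof (rule eliminate_generators[OF \<open>finite B\<close>, of 0])
  have "products B = UNIV"
    using assms products_span[of B] by (simp add: products_def)
  then show "\<forall>x. x - mult 0 x \<in> products B" by (simp add: mult_zero_left)
qed

end

section \<open>Perfect Lie algebras of dimension three\<close>

context lie_algebra
begin

lemma bracket_linear_right: "Vector_Spaces.linear scale scale (bracket x)"
  using bracket_bilinear by (simp add: bilinear_op_def)

lemma bracket_linear_left: "Vector_Spaces.linear scale scale (\<lambda>x. bracket x y)"
  using bracket_bilinear by (simp add: bilinear_op_def)

lemma bracket_add_right: "bracket x (y + z) = bracket x y + bracket x z"
  using bracket_linear_right[of x] by (simp add: Vector_Spaces.linear_iff)

lemma bracket_scale_right: "bracket x (scale r y) = scale r (bracket x y)"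
  using bracket_linear_right[of x] by (simp add: Vector_Spaces.linear_iff)

lemma bracket_add_left: "bracket (x + y) z = bracket x z + bracket y z"
  using bracket_linear_left[of z] by (simp add: Vector_Spaces.linear_iff)

lemma bracket_scale_left: "bracket (scale r x) z = scale r (bracket x z)"
  using bracket_linear_left[of z] by (simp add: Vector_Spaces.linear_iff)

lemma bracket_zero_left: "bracket 0 z = 0"
  using bracket_add_left[of 0 0 z] by simp

lemma bracket_zero_right: "bracket z 0 = 0"
  using bracket_add_right[of z 0 0] by simp

lemma bracket_anticommute: "bracket y x = - bracket x y"
proof -
  have "bracket (x + y) (x + y) = bracket x y + bracket y x"
    by (simp add: bracket_add_left bracket_add_right bracket_self[of x] bracket_self[of y])
  then have "bracket y x + bracket x y = 0"
    by (simp add: bracket_self add.commute)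
  then show ?thesis by (simp only: eq_neg_iff_add_eq_0)
qed

lemma bracket_span:
  assumes W: "subspace W" and gen: "\<And>s t. s \<in> S \<Longrightarrow> t \<in> S \<Longrightarrow> bracket s t \<in> W"
    and "x \<in> span S" and "y \<in> span S"
  shows "bracket x y \<in> W"
proof -
  have right: "bracket s y \<in> W" if "s \<in> S" for s
    using \<open>y \<in> span S\<close>
  proof (induction rule: span_induct_alt)
    case base
    then show ?case by (simp add: bracket_zero_right subspace_0 W)
  next
    case (step r t y)
    then show ?case
      using W gen that by (simp add: bracket_add_right bracket_scale_right subspace_add subspace_scale)
  qed
  show ?thesis using \<open>x \<in> span S\<close>
  proof (induction rule: span_induct_alt)
    case base
    then show ?case by (simp add: bracket_zero_left subspace_0 W)
  next
    case (step r s x)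
    then show ?case
      using W right by (simp add: bracket_add_left bracket_scale_left subspace_add subspace_scale)
  qed
qed

lemma derived_subset_span_brackets:
  assumes "span {a, b, c} = UNIV"
  shows "derived \<subseteq> span {bracket a b, bracket a c, bracket b c}" (is "_ \<subseteq> span ?D")
proof -
  have "bracket s t \<in> span ?D" if "s \<in> {a, b, c}" "t \<in> {a, b, c}" for s t
    using that
    by (auto simp: bracket_self span_zero bracket_anticommute[of b a] bracket_anticommute[of c a]
        bracket_anticommute[of c b] intro!: span_neg intro: span_base)
  then have "bracket x y \<in> span ?D" for x y
    using bracket_span[of "span ?D" "{a, b, c}" x y] assms by (simp add: subspace_span)
  then show ?thesis
    unfolding derived_def by (intro span_minimal) (auto simp: subspace_span)
qed

lemma lie_ideal_bracket:
  assumes "lie_ideal I" "x \<in> I"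
  shows "bracket x y \<in> I" and "bracket y x \<in> I"
proof -
  show "bracket x y \<in> I" using assms by (simp add: lie_ideal_def)
  then show "bracket y x \<in> I"
    unfolding bracket_anticommute[of y x] using assms by (simp add: lie_ideal_def subspace_neg)
qed

text \<open>
  Three elements that span a three-dimensional space are independent, so the brackets of a basis
  are independent.  This turns one nonzero element of an ideal into two independent ones, and two
  into the whole algebra.
\<close>

lemma simple_if_perfect_dim_3:
  assumes dim3: "dim UNIV = 3" and perfect: "derived = UNIV"
  shows "simple"
proof -
  obtain B where B: "independent B" "span B = UNIV" "card B = 3"
    using basis_exists[of UNIV] dim3 by (metis UNIV_I subsetI subset_antisym)
  then have "finite B" by (metis card.infinite zero_neq_numeral)
  interpret finite_dimensional_vector_space scale B
    using B \<open>finite B\<close> by unfold_locales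
  have "\<not> abelian"
  proof
    assume "abelian"
    then have "derived \<subseteq> {0}"
      unfolding derived_def abelian_def by (intro span_minimal) auto
    with perfect have "(UNIV :: 'a set) = {0}" by blast
    then have "dim (UNIV :: 'a set) \<le> card ({} :: 'a set)" by (intro dim_le_card) auto
    with dim3 show False by simp
  qed
  moreover have "I = UNIV" if I: "lie_ideal I" and "I \<noteq> {0}" for I
  proof -
    have sub: "subspace I" using I by (simp add: lie_ideal_def)
    have extend: "\<exists>C. S \<subseteq> C \<and> span C = UNIV \<and> card C = 3 \<and> finite C"
      if "independent S" for S
    proof -
      obtain C where C: "S \<subseteq> C" "independent C" "UNIV \<subseteq> span C"
        using maximal_independent_subset_extend[of S UNIV] \<open>independent S\<close> by (metis subset_UNIV)
      then have span: "span C = UNIV" by (simp only: top.extremum_unique)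
      then have "card C = 3"
        using dim3 dim_span_eq_card_independent[OF C(2)] by simp
      with C span show ?thesis by (metis finiteI_independent)
    qed
    obtain a where a: "a \<in> I" "a \<noteq> 0"
      using \<open>I \<noteq> {0}\<close> subspace_0[OF sub] by blast
    then have "independent {a}" by simp
    then obtain C where C: "a \<in> C" "span C = UNIV" "card C = 3" "finite C"
      using extend by blast
    then have "card (C - {a}) = 2" by simp
    then obtain b c where "C - {a} = {b, c}" by (meson card_2_iff)
    then have "span {a, b, c} = UNIV" using C by (metis insert_Diff)
    then have D: "span {bracket a b, bracket a c, bracket b c} = UNIV" (is "span ?D = _")
      using derived_subset_span_brackets perfect by blast
    have "card ?D \<le> 3" by (simp add: card_insert_if)
    then have indep: "independent ?D"
      using D dim3 by (intro card_le_dim_spanning[of _ UNIV]) auto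
    have "3 \<le> card ?D"
      using D dim3 by (metis dim_span_eq_card_independent indep order_refl)
    then have ne: "bracket a b \<noteq> bracket a c"
      by (auto simp: card_insert_if split: if_splits)
    define p where "p = bracket a b"
    define q where "q = bracket a c"
    have "independent {p, q}"
      using independent_mono[OF indep, of "{p, q}"] by (auto simp: p_def q_def)
    then obtain E where E: "{p, q} \<subseteq> E" "span E = UNIV" "card E = 3" "finite E"
      using extend by blast
    have "card (E - {p, q}) = 1"
      using E ne by (subst card_Diff_subset) (auto simp: p_def q_def)
    then obtain r where "E - {p, q} = {r}" by (meson card_1_singletonE)
    with E(1) have "E = {p, q, r}" by blast
    then have "span {p, q, r} = UNIV" using E by blast
    then have "span {bracket p q, bracket p r, bracket q r} = UNIV"
      using derived_subset_span_brackets perfect by blast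
    moreover have "p \<in> I" "q \<in> I"
      using lie_ideal_bracket(1)[OF I] a by (auto simp: p_def q_def)
    then have "span {bracket p q, bracket p r, bracket q r} \<subseteq> I"
      using lie_ideal_bracket[OF I] by (intro span_minimal sub) auto
    ultimately show ?thesis by blast
  qed
  ultimately show ?thesis unfolding simple_def by blast
qed

lemma simple_center_trivial:
  assumes "simple" and "\<forall>z. bracket x z = 0"
  shows "x = 0"
proof -
  define Z where "Z = {x. \<forall>z. bracket x z = 0}"
  have "lie_ideal Z"
    by (auto simp: lie_ideal_def Z_def subspace_def bracket_zero_left bracket_add_left
        bracket_scale_left)
  then have "Z = {0} \<or> Z = UNIV" using assms by (simp add: simple_def)
  moreover have "Z \<noteq> UNIV" using assms by (auto simp: simple_def abelian_def Z_def)
  ultimately show ?thesis using assms(2) by (auto simp: Z_def)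
qed

end

section \<open>The product of a Poisson algebra with simple Lie algebra\<close>

context poisson_algebra
begin

sublocale commutative_algebra scale mult
  by unfold_locales (fact mult_bilinear mult_commute mult_assoc)+

text \<open>The Leibniz rule writes the bracket of a product as a sum of products.\<close>

lemma square_lie_ideal: "lie_ideal square"
proof -
  have mem: "mult x y \<in> square" for x y
    unfolding square_def by (rule span_base) blast
  have "bracket x z \<in> square" if "x \<in> square" for x z
    using that unfolding square_def
  proof (induction rule: span_induct_alt)
    case base
    then show ?case by (simp add: bracket_zero_left span_zero)
  next
    case (step r m y)
    then obtain u v where "m = mult u v" by blast
    then have "bracket m z \<in> span {mult x y | x y. True}"
      using mem by (simp add: leibniz square_def span_add)
    with step show ?case
      by (simp add: bracket_add_left bracket_scale_left span_add span_scale)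
  qed
  then show ?thesis by (simp add: lie_ideal_def square_def subspace_span)
qed

lemma identity_central:
  assumes "\<forall>x. mult e x = x"
  shows "bracket e z = 0"
  using leibniz[of e e z] assms by simp

lemma square_zero_if_simple:
  assumes "finite B" and "span B = UNIV" and "simple"
  shows "square = {0}"
proof (rule ccontr)
  assume "square \<noteq> {0}"
  then have "square = UNIV"
    using \<open>simple\<close> square_lie_ideal by (auto simp: simple_def)
  then obtain e where e: "\<forall>x. mult e x = x"
    using identity_if_square_UNIV[OF assms(1,2)] unfolding square_def by blast
  then have "e = 0"
    using simple_center_trivial \<open>simple\<close> identity_central by blast
  then have "x = 0" for x :: 'a
    using e mult_zero_left by metis
  then have "abelian" by (simp add: abelian_def)
  with \<open>simple\<close> show False by (simp add: simple_def)
qed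

end

lemma (in lie_algebra) poisson_algebra_zero_mult:
  "poisson_algebra scale bracket (\<lambda>x y. 0)"
  by unfold_locales (simp_all add: bilinear_op_def Vector_Spaces.linear_iff vector_space_axioms bracket_zero_left)

theorem theorem5p6:
  fixes scale :: "'f::field \<Rightarrow> 'a::ab_group_add \<Rightarrow> 'a"
  shows "(\<forall>bracket mult.
            poisson_algebra scale bracket mult \<and>
            vector_space.dim scale UNIV = 3 \<and>
            lie_algebra.derived scale bracket = UNIV \<longrightarrow>
              lie_algebra.simple scale bracket \<and>
              poisson_algebra.square scale mult = {0}) \<and>
         (\<forall>bracket.
            lie_algebra scale bracket \<and>
            vector_space.dim scale UNIV = 3 \<and>
            lie_algebra.simple scale bracket \<longrightarrow>
              poisson_algebra scale bracket (\<lambda>x y. 0))"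
proof (intro conjI allI impI; elim conjE)
  fix bracket mult :: "'a \<Rightarrow> 'a \<Rightarrow> 'a"
  assume "poisson_algebra scale bracket mult"
    and dim3: "vector_space.dim scale UNIV = 3"
    and perfect: "lie_algebra.derived scale bracket = UNIV"
  then interpret poisson_algebra scale bracket mult by simp
  show simp: "lie_algebra.simple scale bracket"
    using simple_if_perfect_dim_3 dim3 perfect .
  obtain B where "span B = UNIV" "card B = 3"
    using basis_exists[of UNIV] dim3 by (metis UNIV_I subsetI subset_antisym)
  moreover then have "finite B" by (metis card.infinite zero_neq_numeral)
  ultimately show "poisson_algebra.square scale mult = {0}"
    using square_zero_if_simple simp by blast
next
  fix bracket :: "'a \<Rightarrow> 'a \<Rightarrow> 'a"
  assume "lie_algebra scale bracket"
  then show "poisson_algebra scale bracket (\<lambda>x y. 0)"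
    by (rule lie_algebra.poisson_algebra_zero_mult)
qed

end
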